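(* Let $\varphi_1,\varphi_2:\mathbb{M}(n)\to\mathbb{C}$ be positive unital linear functionals, and let $A,B\in\mathbb{M}(n)$ be normal matrices with eigenvalues $\lambda_1(A),\dots,\lambda_n(A)$ and $\lambda_1(B),\dots,\lambda_n(B)$, respectively. Then $$\left|\varphi_1(A)-\varphi_2(B)\right|\le\max_{1\le i,j\le n}\left|\lambda_i(A)-\lambda_j(B)\right|.$$
   Context: $\mathbb{M}(n)$ is the algebra of all $n\times n$ complex matrices. A linear functional $\varphi:\mathbb{M}(n)\to\mathbb{C}$ is positive if $\varphi(A)\ge 0$ whenever $A$ is positive semidefinite, and unital if $\varphi(I)=1$. *)

theory Defs
  imports
    "Jordan_Normal_Form.Schur_Decomposition"
begin

text \<open>The algebra of all complex \<open>n \<times> n\<close> matrices is \<open>carrier_mat n n\<close>. The order on the complex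
  numbers is the one of \<open>HOL-Library.Complex_Order\<close>: \<open>0 \<le> z\<close> says that \<open>z\<close> is real and nonnegative.\<close>

text \<open>Over the complex numbers the condition below entails that \<open>A\<close> is Hermitian, because every
  value of its quadratic form is required to be real.\<close>

definition pos_semidef :: "nat \<Rightarrow> complex mat \<Rightarrow> bool" where
  "pos_semidef n A \<longleftrightarrow>
     A \<in> carrier_mat n n \<and> (\<forall>v \<in> carrier_vec n. 0 \<le> (A *\<^sub>v v) \<bullet>c v)"

definition normal_mat :: "nat \<Rightarrow> complex mat \<Rightarrow> bool" where
  "normal_mat n A \<longleftrightarrow>
     A \<in> carrier_mat n n \<and> A * mat_adjoint A = mat_adjoint A * A"

text \<open>Functionals are HOL functions on all matrices; only their values on \<open>carrier_mat n n\<close> are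
  constrained.\<close>

definition linear_functional :: "nat \<Rightarrow> (complex mat \<Rightarrow> complex) \<Rightarrow> bool" where
  "linear_functional n \<phi> \<longleftrightarrow>
     (\<forall>A \<in> carrier_mat n n. \<forall>B \<in> carrier_mat n n. \<phi> (A + B) = \<phi> A + \<phi> B) \<and>
     (\<forall>c. \<forall>A \<in> carrier_mat n n. \<phi> (c \<cdot>\<^sub>m A) = c * \<phi> A)"

definition positive_functional :: "nat \<Rightarrow> (complex mat \<Rightarrow> complex) \<Rightarrow> bool" where
  "positive_functional n \<phi> \<longleftrightarrow> (\<forall>A. pos_semidef n A \<longrightarrow> 0 \<le> \<phi> A)"

definition unital_functional :: "nat \<Rightarrow> (complex mat \<Rightarrow> complex) \<Rightarrow> bool" where
  "unital_functional n \<phi> \<longleftrightarrow> \<phi> (1\<^sub>m n) = 1"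

text \<open>\<open>ev 1, \<dots>, ev n\<close> lists the eigenvalues of \<open>A\<close> with algebraic multiplicity, in arbitrary order.\<close>

definition eigenvalue_enum :: "nat \<Rightarrow> complex mat \<Rightarrow> (nat \<Rightarrow> complex) \<Rightarrow> bool" where
  "eigenvalue_enum n A ev \<longleftrightarrow> char_poly A = (\<Prod>i = 1..n. [:- ev i, 1:])"

end

theory Submission
  imports Defs
begin

text \<open>A normal matrix is unitarily similar to \<open>e \<oplus> X\<close> with \<open>X\<close> normal, and a positive functional
  on \<open>e \<oplus> X\<close> is a nonnegative multiple of \<open>e\<close> plus a positive functional of \<open>X\<close>. By induction, a
  positive unital functional maps a normal matrix to a convex combination of its eigenvalues, so
  \<open>\<phi>\<^sub>1(A) - \<phi>\<^sub>2(B)\<close> is a convex combination of the differences \<open>\<lambda>\<^sub>i(A) - \<lambda>\<^sub>j(B)\<close>.\<close>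

section \<open>The conjugate transpose\<close>

lemma dim_mat_adjoint [simp]:
  "dim_row (mat_adjoint A) = dim_col A" "dim_col (mat_adjoint A) = dim_row A"
  by (auto simp: mat_adjoint_def)

lemma mat_adjoint_carrier [simp]: "A \<in> carrier_mat m n \<Longrightarrow> mat_adjoint A \<in> carrier_mat n m"
  by auto

lemma index_mat_adjoint [simp]:
  "i < dim_col A \<Longrightarrow> j < dim_row A \<Longrightarrow> mat_adjoint A $$ (i, j) = conjugate (A $$ (j, i))"
  by (simp add: mat_adjoint_def mat_of_rows_index)

lemma mat_adjoint_adjoint [simp]: "mat_adjoint (mat_adjoint A) = A"
  by (rule eq_matI) auto

lemma mat_adjoint_mult:
  fixes A :: "complex mat"
  assumes "A \<in> carrier_mat l m" "B \<in> carrier_mat m n"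
  shows "mat_adjoint (A * B) = mat_adjoint B * mat_adjoint A"
  using assms by (intro eq_matI) (auto simp: scalar_prod_def mult.commute)

section \<open>Adjoints in quadratic forms, and congruences\<close>

lemma mult_mat_vec_cscalar_prod:
  fixes A :: "complex mat"
  assumes A: "A \<in> carrier_mat m n" and v: "v \<in> carrier_vec n" and w: "w \<in> carrier_vec m"
  shows "(A *\<^sub>v v) \<bullet>c w = v \<bullet>c (mat_adjoint A *\<^sub>v w)"
proof -
  have "(A *\<^sub>v v) \<bullet>c w = (\<Sum>i<m. \<Sum>j<n. A $$ (i, j) * v $ j * cnj (w $ i))"
    using assms by (auto simp: scalar_prod_def lessThan_atLeast0 sum_distrib_right intro!: sum.cong)
  also have "\<dots> = (\<Sum>j<n. \<Sum>i<m. A $$ (i, j) * v $ j * cnj (w $ i))"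
    by (rule sum.swap)
  also have "\<dots> = v \<bullet>c (mat_adjoint A *\<^sub>v w)"
    using assms by (auto simp: scalar_prod_def lessThan_atLeast0 sum_distrib_left mult_ac intro!: sum.cong)
  finally show ?thesis .
qed

text \<open>Moving the outer factor \<open>W\<close> across the inner product turns the quadratic
  form at \<open>v\<close> into that of \<open>X\<close> at
  \<open>mat_adjoint W *\<^sub>v v\<close>. This works for rectangular \<open>W\<close>.\<close>

lemma pos_semidef_congruence:
  assumes "pos_semidef n X" "W \<in> carrier_mat m n"
  shows "pos_semidef m (W * X * mat_adjoint W)"
  unfolding pos_semidef_def
proof (intro conjI ballI)
  have X: "X \<in> carrier_mat n n" and pos: "\<And>u. u \<in> carrier_vec n \<Longrightarrow> 0 \<le> (X *\<^sub>v u) \<bullet>c u"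
    using assms(1) by (auto simp: pos_semidef_def)
  note W = assms(2) mat_adjoint_carrier[OF assms(2)]
  show "W * X * mat_adjoint W \<in> carrier_mat m m"
    using X W by auto
  fix v :: "complex vec" assume v: "v \<in> carrier_vec m"
  define u where "u = mat_adjoint W *\<^sub>v v"
  have u: "u \<in> carrier_vec n"
    unfolding u_def using W(2) v by (rule mult_mat_vec_carrier)
  have "W * X * mat_adjoint W *\<^sub>v v = W * X *\<^sub>v u"
    using W X v unfolding u_def by (intro assoc_mult_mat_vec[of _ m n]) auto
  also have "\<dots> = W *\<^sub>v (X *\<^sub>v u)"
    using W X u by (intro assoc_mult_mat_vec[of _ m n]) auto
  finally have "(W * X * mat_adjoint W *\<^sub>v v) \<bullet>c v = (X *\<^sub>v u) \<bullet>c u"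
    using mult_mat_vec_cscalar_prod[OF W(1) mult_mat_vec_carrier[OF X u] v] by (simp add: u_def)
  then show "0 \<le> (W * X * mat_adjoint W *\<^sub>v v) \<bullet>c v"
    using pos[OF u] by simp
qed

text \<open>Since \<open>W * mat_adjoint W\<close> cancels between two factors, conjugation by
  \<open>W\<close> is multiplicative. It also commutes with the adjoint, so it carries the
  commutation of \<open>A\<close> with its adjoint over.\<close>

lemma normal_mat_congruence:
  assumes A: "normal_mat n A" and W: "W \<in> carrier_mat n n" "W * mat_adjoint W = 1\<^sub>m n"
  shows "normal_mat n (mat_adjoint W * A * W)"
proof -
  have carr: "A \<in> carrier_mat n n" "mat_adjoint A \<in> carrier_mat n n" "mat_adjoint W \<in> carrier_mat n n"
    and norm: "A * mat_adjoint A = mat_adjoint A * A"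
    using A W by (auto simp: normal_mat_def)
  have adj: "mat_adjoint (mat_adjoint W * A * W) = mat_adjoint W * mat_adjoint A * W"
    using W carr by (simp add: mat_adjoint_mult[of _ n n _ n] assoc_mult_mat[of _ n n _ n _ n] mult_carrier_mat[of _ n n _ n])
  have cancel: "(mat_adjoint W * X * W) * (mat_adjoint W * Y * W) = mat_adjoint W * (X * Y) * W"
    if X: "X \<in> carrier_mat n n" and Y: "Y \<in> carrier_mat n n" for X Y
  proof -
    have "(mat_adjoint W * X * W) * (mat_adjoint W * Y * W)
        = mat_adjoint W * X * ((W * mat_adjoint W) * (Y * W))"
      using X Y W(1) carr by (simp add: assoc_mult_mat[of _ n n _ n _ n] mult_carrier_mat[of _ n n _ n])
    then show ?thesis
      using X Y W carr by (simp add: assoc_mult_mat[of _ n n _ n _ n] mult_carrier_mat[of _ n n _ n])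
  qed
  show ?thesis
    using W(1) carr norm by (simp add: normal_mat_def adj cancel mult_carrier_mat[of _ n n _ n])
qed

section \<open>Unitary matrices with a prescribed first column\<close>

text \<open>Complete \<open>v\<close> to a basis, apply Gram-Schmidt, which keeps the first vector,
  and normalise; the results are the columns of \<open>W\<close>. The scalar \<open>c\<close>
  absorbs the normalisation of \<open>v\<close> and is harmless for eigenvectors.\<close>

lemma unitary_completion:
  fixes v :: "complex vec"
  assumes v: "v \<in> carrier_vec n" "v \<noteq> 0\<^sub>v n"
  obtains W c where "W \<in> carrier_mat n n" "mat_adjoint W * W = 1\<^sub>m n" "W * mat_adjoint W = 1\<^sub>m n"
    "col W 0 = c \<cdot>\<^sub>v v"
proof -
  interpret cof_vec_space n "TYPE(complex)" .
  have n: "0 < n"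
    using v by (cases n) auto
  define b where "b = basis_completion v"
  have b: "set b \<subseteq> carrier_vec n" "distinct b" "\<not> lin_dep (set b)" "length b = n" "hd b = v"
    using basis_completion[OF v] by (auto simp: b_def)
  then obtain vs where bv: "b = v # vs"
    using n by (cases b) auto
  define ws where "ws = gram_schmidt n b"
  have ws: "set ws \<subseteq> carrier_vec n" "corthogonal ws" "length ws = n"
    using gram_schmidt_result[OF b(1-3) ws_def] b(4) by auto
  have hd: "hd ws = v"
    using gram_schmidt_hd[OF v(1), of vs] by (simp add: ws_def bv)
  \<comment> \<open>The reciprocal of the Euclidean norm. The square \<open>w \<bullet>c w\<close>
    is a complex number that happens to be real and nonnegative, hence the \<open>Re\<close> under
    the root.\<close>
  define s where "s w = complex_of_real (1 / sqrt (Re (w \<bullet>c w)))" for w :: "complex vec"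
  have s: "s w * s w * (w \<bullet>c w) = 1" if "w \<bullet>c w \<noteq> 0" for w
  proof -
    have "0 \<le> w \<bullet>c w"
      by (rule conjugate_square_ge_0_vec)
    then have eq: "w \<bullet>c w = of_real (Re (w \<bullet>c w))" and "0 \<le> Re (w \<bullet>c w)"
      by (auto simp: less_eq_complex_def complex_eq_iff)
    with that have pos: "0 < Re (w \<bullet>c w)"
      by (metis less_eq_real_def of_real_0)
    define r where "r = Re (w \<bullet>c w)"
    have "1 / sqrt r * (1 / sqrt r) * r = 1"
      using pos by (simp add: field_simps flip: r_def)
    then have "complex_of_real (1 / sqrt r) * of_real (1 / sqrt r) * of_real r = 1"
      by (metis of_real_1 of_real_mult)
    then show ?thesis
      unfolding s_def r_def[symmetric] by (simp only: eq[folded r_def])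
  qed
  define W where "W = mat_of_cols n (map (\<lambda>w. s w \<cdot>\<^sub>v w) ws)"
  have W: "W \<in> carrier_mat n n"
    unfolding W_def by (rule carrier_matI) (simp_all add: ws(3))
  have wi: "ws ! i \<in> carrier_vec n" if "i < n" for i
    using ws(1) nth_mem[of i ws] that ws(3) by blast
  have colW: "col W i = s (ws ! i) \<cdot>\<^sub>v ws ! i" if "i < n" for i
    using that ws(3) wi[OF that] by (simp add: W_def)
  have prod: "mat_adjoint W * W = 1\<^sub>m n"
  proof (rule eq_matI)
    fix i j assume "i < dim_row (1\<^sub>m n :: complex mat)" "j < dim_col (1\<^sub>m n :: complex mat)"
    then have i: "i < n" and j: "j < n"
      by auto
    have row: "row (mat_adjoint W) i = conjugate (col W i)"
      using i W by (intro eq_vecI) auto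
    have "(mat_adjoint W * W) $$ (i, j) = conjugate (col W i) \<bullet> col W j"
      using i j W by (simp add: row)
    also have "\<dots> = col W j \<bullet>c col W i"
      using W i j by (intro comm_scalar_prod[of _ n]) auto
    \<comment> \<open>The factors \<open>s\<close> are real, so they leave the conjugated argument
      unchanged.\<close>
    also have "\<dots> = s (ws ! j) * s (ws ! i) * (ws ! j \<bullet>c ws ! i)"
      using wi[OF i] wi[OF j] by (simp add: colW[OF i] colW[OF j] conjugate_smult_vec s_def mult.commute)
    also have "\<dots> = 1\<^sub>m n $$ (i, j)"
      using corthogonalD[OF ws(2), of j i] i j ws(3) s[of "ws ! i"] by (cases "i = j") auto
    finally show "(mat_adjoint W * W) $$ (i, j) = 1\<^sub>m n $$ (i, j)" .
  qed (use W in auto)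
  have prod': "W * mat_adjoint W = 1\<^sub>m n"
    using mat_mult_left_right_inverse[OF mat_adjoint_carrier[OF W] W prod] .
  have "ws ! 0 = v"
    using hd n ws(3) by (cases ws) auto
  then show thesis
    using that[OF W prod prod'] colW[OF n] by simp
qed

section \<open>Bordering by a scalar\<close>

text \<open>The direct sum of the scalar \<open>c\<close> and \<open>X\<close>. The size
  \<open>m\<close> is passed explicitly because it fixes the shape of the two zero blocks.\<close>

definition scalar_block :: "nat \<Rightarrow> complex \<Rightarrow> complex mat \<Rightarrow> complex mat" where
  "scalar_block m c X = four_block_mat (mat 1 1 (\<lambda>_. c)) (0\<^sub>m 1 m) (0\<^sub>m m 1) X"

lemma dim_scalar_block [simp]:
  "dim_row (scalar_block m c X) = Suc (dim_row X)" "dim_col (scalar_block m c X) = Suc (dim_col X)"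
  by (simp_all add: scalar_block_def)

lemma scalar_block_carrier [simp]:
  "X \<in> carrier_mat m m \<Longrightarrow> scalar_block m c X \<in> carrier_mat (Suc m) (Suc m)"
  by auto

lemma index_scalar_block:
  assumes "X \<in> carrier_mat m m" "i < Suc m" "j < Suc m"
  shows "scalar_block m c X $$ (i, j) =
    (if i = 0 then if j = 0 then c else 0 else if j = 0 then 0 else X $$ (i - 1, j - 1))"
  using assms by (cases i; cases j) (simp_all add: scalar_block_def)

lemma scalar_block_mult:
  assumes "X \<in> carrier_mat m m" "Y \<in> carrier_mat m m"
  shows "scalar_block m c X * scalar_block m d Y = scalar_block m (c * d) (X * Y)"
proof -
  have "mat 1 1 (\<lambda>_. c) * mat 1 1 (\<lambda>_. d) = mat 1 1 (\<lambda>_. c * d)"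
    by (intro eq_matI) (auto simp: scalar_prod_def)
  then show ?thesis
    using assms unfolding scalar_block_def
    by (subst mult_four_block_mat[of _ 1 1 _ m _ m _ _ 1 _ m]) auto
qed

lemma scalar_block_add:
  assumes "X \<in> carrier_mat m m" "Y \<in> carrier_mat m m"
  shows "scalar_block m c X + scalar_block m d Y = scalar_block m (c + d) (X + Y)"
  using assms
  by (intro eq_matI) (auto simp: index_scalar_block)

lemma scalar_block_smult:
  assumes "X \<in> carrier_mat m m"
  shows "d \<cdot>\<^sub>m scalar_block m c X = scalar_block m (d * c) (d \<cdot>\<^sub>m X)"
  using assms
  by (intro eq_matI) (auto simp: index_scalar_block)

lemma scalar_block_one: "scalar_block m 1 (1\<^sub>m m) = 1\<^sub>m (Suc m)"
  by (intro eq_matI) (auto simp: index_scalar_block)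

lemma scalar_block_adjoint:
  assumes "X \<in> carrier_mat m m"
  shows "mat_adjoint (scalar_block m c X) = scalar_block m (cnj c) (mat_adjoint X)"
  using assms
  by (intro eq_matI) (auto simp: index_scalar_block)

lemma scalar_block_inject:
  assumes X: "X \<in> carrier_mat m m" and Y: "Y \<in> carrier_mat m m"
    and eq: "scalar_block m c X = scalar_block m d Y"
  shows "X = Y"
proof (rule eq_matI)
  fix i j assume "i < dim_row Y" "j < dim_col Y"
  then show "X $$ (i, j) = Y $$ (i, j)"
    using arg_cong[OF eq, of "\<lambda>Z. Z $$ (Suc i, Suc j)"] X Y by (simp add: index_scalar_block)
qed (use X Y in auto)

text \<open>Adjoints and products of direct sums are formed blockwise, so the commutation can be
  read off in the lower block.\<close>

lemma normal_mat_scalar_blockD: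
  assumes "normal_mat (Suc m) (scalar_block m c X)" "X \<in> carrier_mat m m"
  shows "normal_mat m X"
proof -
  have "scalar_block m (c * cnj c) (X * mat_adjoint X) = scalar_block m (cnj c * c) (mat_adjoint X * X)"
    using assms by (simp add: normal_mat_def scalar_block_adjoint scalar_block_mult)
  then have "X * mat_adjoint X = mat_adjoint X * X"
    by (rule scalar_block_inject[rotated 2]) (use assms(2) in auto)
  then show ?thesis
    using assms(2) by (simp add: normal_mat_def)
qed

text \<open>At a vector with head \<open>a\<close> and tail \<open>w\<close>, the quadratic form
  splits into \<open>c * (a * cnj a)\<close> plus the form of \<open>X\<close> at \<open>w\<close>;
  both are nonnegative.\<close>

lemma pos_semidef_scalar_block:
  assumes X: "pos_semidef m X" and c: "0 \<le> c"
  shows "pos_semidef (Suc m) (scalar_block m c X)"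
  unfolding pos_semidef_def
proof (intro conjI ballI)
  have Xc: "X \<in> carrier_mat m m"
    using X by (simp add: pos_semidef_def)
  then show "scalar_block m c X \<in> carrier_mat (Suc m) (Suc m)"
    by simp
  fix v :: "complex vec" assume "v \<in> carrier_vec (Suc m)"
  then obtain a w where v: "v = vCons a w" and w: "w \<in> carrier_vec m"
    by (cases v) auto
  have "scalar_block m c X *\<^sub>v v = vCons (c * a) (X *\<^sub>v w)"
  proof (rule eq_vecI)
    fix i assume "i < dim_vec (vCons (c * a) (X *\<^sub>v w))"
    then have i: "i < Suc m"
      using Xc by simp
    have "(scalar_block m c X *\<^sub>v v) $ i = (\<Sum>j<Suc m. scalar_block m c X $$ (i, j) * v $ j)"
      using i Xc w
      by (auto simp: v scalar_prod_def lessThan_atLeast0 simp del: sum.op_ivl_Suc intro!: sum.cong)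
    also have "\<dots> = vCons (c * a) (X *\<^sub>v w) $ i"
      using i Xc w by (cases i)
        (auto simp: sum.lessThan_Suc_shift index_scalar_block v scalar_prod_def
          simp del: sum.lessThan_Suc sum.op_ivl_Suc simp flip: lessThan_atLeast0)
    finally show "(scalar_block m c X *\<^sub>v v) $ i = vCons (c * a) (X *\<^sub>v w) $ i" .
  qed (use Xc in auto)
  then have "(scalar_block m c X *\<^sub>v v) \<bullet>c v = c * (a * cnj a) + (X *\<^sub>v w) \<bullet>c w"
    by (simp add: v)
  moreover have "0 \<le> (X *\<^sub>v w) \<bullet>c w"
    using X w by (simp add: pos_semidef_def)
  moreover have "0 \<le> c * (a * cnj a)"
    by (rule mult_nonneg_nonneg[OF c]) (simp add: less_eq_complex_def)
  ultimately show "0 \<le> (scalar_block m c X *\<^sub>v v) \<bullet>c v"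
    by simp
qed

lemma char_poly_scalar_block:
  assumes "X \<in> carrier_mat m m"
  shows "char_poly (scalar_block m c X) = [:- c, 1:] * char_poly X"
proof -
  have "char_poly (mat 1 1 (\<lambda>_. c)) = [:- c, 1:]"
    by (simp add: char_poly_defs det_def sign_def)
  then show ?thesis
    unfolding scalar_block_def using assms
    by (subst char_poly_four_block_zeros_col[of _ _ m]) auto
qed

text \<open>Comparing the \<open>(0, 0)\<close> entries of \<open>A A\<^sup>*\<close> and \<open>A\<^sup>* A\<close> shows that the first row of a normal
  matrix has the same Euclidean norm as its first column.\<close>

lemma normal_mat_split:
  assumes A: "normal_mat (Suc m) A" and col: "col A 0 = c \<cdot>\<^sub>v unit_vec (Suc m) 0"
  obtains X where "X \<in> carrier_mat m m" "normal_mat m X" "A = scalar_block m c X"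
proof -
  have carr: "A \<in> carrier_mat (Suc m) (Suc m)" and norm: "A * mat_adjoint A = mat_adjoint A * A"
    using A by (auto simp: normal_mat_def)
  have col0: "A $$ (i, 0) = (if i = 0 then c else 0)" if "i < Suc m" for i
    using arg_cong[OF col, of "\<lambda>v. v $ i"] that carr by auto
  have "(A * mat_adjoint A) $$ (0, 0) = (\<Sum>j<Suc m. of_real ((cmod (A $$ (0, j)))\<^sup>2))"
    using carr by (auto simp: scalar_prod_def lessThan_atLeast0 complex_norm_square 
        simp del: sum.op_ivl_Suc of_real_power intro!: sum.cong)
  moreover have "(mat_adjoint A * A) $$ (0, 0) = (\<Sum>j<Suc m. of_real ((cmod (A $$ (j, 0)))\<^sup>2))"
    using carr by (auto simp: scalar_prod_def lessThan_atLeast0 complex_norm_square mult.commute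
        simp del: sum.op_ivl_Suc of_real_power intro!: sum.cong)
  ultimately have "complex_of_real (\<Sum>j<Suc m. (cmod (A $$ (0, j)))\<^sup>2)
      = of_real (\<Sum>j<Suc m. (cmod (A $$ (j, 0)))\<^sup>2)"
    unfolding of_real_sum norm by (rule trans[OF sym])
  then have "(\<Sum>j<Suc m. (cmod (A $$ (0, j)))\<^sup>2) = (\<Sum>j<Suc m. (cmod (A $$ (j, 0)))\<^sup>2)"
    by (simp only: of_real_eq_iff)
  \<comment> \<open>The first column is zero below the corner, so only the corner term remains on
    the right, and it cancels against the same term on the left.\<close>
  then have "(\<Sum>j<m. (cmod (A $$ (0, Suc j)))\<^sup>2) = 0"
    by (simp add: sum.lessThan_Suc_shift col0 del: sum.lessThan_Suc)
  then have row0: "A $$ (0, Suc j) = 0" if "j < m" for j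
    using that by (simp add: sum_nonneg_eq_0_iff)
  define X where "X = mat m m (\<lambda>(i, j). A $$ (Suc i, Suc j))"
  have X: "X \<in> carrier_mat m m"
    by (simp add: X_def)
  have AX: "A = scalar_block m c X"
  proof (rule eq_matI)
    fix i j assume "i < dim_row (scalar_block m c X)" "j < dim_col (scalar_block m c X)"
    then have "i < Suc m" "j < Suc m"
      using X by auto
    then show "A $$ (i, j) = scalar_block m c X $$ (i, j)"
      using X by (cases i; cases j) (auto simp: index_scalar_block col0 row0 X_def)
  qed (use carr X in auto)
  show thesis
    using that[OF X _ AX] normal_mat_scalar_blockD[OF _ X] A AX by simp
qed

section \<open>Positive functionals on normal matrices\<close>

lemma linear_functionalD:
  assumes "linear_functional n \<phi>" "X \<in> carrier_mat n n"
  shows "Y \<in> carrier_mat n n \<Longrightarrow> \<phi> (X + Y) = \<phi> X + \<phi> Y" "\<phi> (c \<cdot>\<^sub>m X) = c * \<phi> X"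
  using assms unfolding linear_functional_def by blast+

text \<open>For unitary \<open>W\<close> this pullback is the functional read in another basis: its
  value at \<open>mat_adjoint W * A * W\<close> is the value of \<open>\<phi>\<close> at
  \<open>A\<close>.\<close>

lemma linear_functional_congruence:
  assumes \<phi>: "linear_functional n \<phi>" and W: "W \<in> carrier_mat n m"
  shows "linear_functional m (\<lambda>X. \<phi> (W * X * mat_adjoint W))"
proof -
  have "W * (X + Y) * mat_adjoint W = W * X * mat_adjoint W + W * Y * mat_adjoint W"
    if "X \<in> carrier_mat m m" "Y \<in> carrier_mat m m" for X Y
    using that W by (simp add: mult_add_distrib_mat[of _ n m _ m] add_mult_distrib_mat[of _ n m _ _ n])
  moreover have "W * (c \<cdot>\<^sub>m X) * mat_adjoint W = c \<cdot>\<^sub>m (W * X * mat_adjoint W)"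
    if "X \<in> carrier_mat m m" for X c
    using that W
    by (simp add: mult_smult_distrib[of _ n m _ m] mult_smult_assoc_mat[of _ n m _ n])
  moreover have "W * X * mat_adjoint W \<in> carrier_mat n n" if "X \<in> carrier_mat m m" for X
    using that W by (auto intro!: carrier_matI)
  ultimately show ?thesis
    unfolding linear_functional_def by (simp add: linear_functionalD[OF \<phi>])
qed

lemma positive_functional_congruence:
  assumes "positive_functional n \<phi>" "W \<in> carrier_mat n m"
  shows "positive_functional m (\<lambda>X. \<phi> (W * X * mat_adjoint W))"
  using assms pos_semidef_congruence by (auto simp: positive_functional_def)

lemma linear_functional_scalar_block:
  assumes "linear_functional (Suc m) \<psi>"
  shows "linear_functional m (\<lambda>X. \<psi> (scalar_block m 0 X))"
proof -
  have "scalar_block m 0 (X + Y) = scalar_block m 0 X + scalar_block m 0 Y"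
    if "X \<in> carrier_mat m m" "Y \<in> carrier_mat m m" for X Y
    using that by (simp add: scalar_block_add)
  moreover have "scalar_block m 0 (c \<cdot>\<^sub>m X) = c \<cdot>\<^sub>m scalar_block m 0 X"
    if "X \<in> carrier_mat m m" for X c
    using that by (simp add: scalar_block_smult)
  ultimately show ?thesis
    unfolding linear_functional_def by (simp add: linear_functionalD[OF assms])
qed

lemma positive_functional_scalar_block:
  assumes "positive_functional (Suc m) \<psi>"
  shows "positive_functional m (\<lambda>X. \<psi> (scalar_block m 0 X))"
  using assms pos_semidef_scalar_block by (auto simp: positive_functional_def)

text \<open>The direct sum of \<open>c\<close> and \<open>X\<close> is \<open>c\<close> times the
  projection onto the first coordinate plus the direct sum of 0 and \<open>X\<close>. The value of
  \<open>\<psi>\<close> at that projection becomes the weight of the eigenvalue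
  \<open>c\<close>.\<close>

lemma linear_functional_decompose:
  assumes \<psi>: "linear_functional (Suc m) \<psi>" and X: "X \<in> carrier_mat m m"
  shows "\<psi> (scalar_block m c X) = c * \<psi> (scalar_block m 1 (0\<^sub>m m m)) + \<psi> (scalar_block m 0 X)"
proof -
  have "scalar_block m c X = c \<cdot>\<^sub>m scalar_block m 1 (0\<^sub>m m m) + scalar_block m 0 X"
    using X by (simp add: scalar_block_smult scalar_block_add)
  then show ?thesis
    using X by (simp add: linear_functionalD[OF \<psi>])
qed

text \<open>Induction on the size, splitting off one eigenvector at a time. Unitality would not
  survive the restriction to the lower block, so the total weight is left as the value of
  \<open>\<phi>\<close> at the identity and is normalised only afterwards.\<close>

lemma positive_functional_normal:
  fixes \<phi> :: "complex mat \<Rightarrow> complex" and ev :: "nat \<Rightarrow> complex"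
  assumes "linear_functional n \<phi>" "positive_functional n \<phi>" "normal_mat n A"
    and "char_poly A = (\<Prod>i<n. [:- ev i, 1:])"
  shows "\<exists>w :: nat \<Rightarrow> real. (\<forall>i<n. (0::real) \<le> w i) \<and> \<phi> (1\<^sub>m n) = (\<Sum>i<n. w i) \<and>
           \<phi> A = (\<Sum>i<n. w i * ev i)"
  using assms
proof (induction n arbitrary: \<phi> A ev)
  case 0
  \<comment> \<open>In size zero every matrix equals its multiple by 0, so linearity makes
    \<open>\<phi>\<close> vanish, in agreement with the empty sums.\<close>
  have zero: "\<phi> X = 0" if "X \<in> carrier_mat 0 0" for X
  proof -
    have "0 \<cdot>\<^sub>m X = X"
      using that by (intro eq_matI) auto
    then show ?thesis
      using linear_functionalD(2)[OF 0(1) that, of 0] by simp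
  qed
  show ?case
    using 0 by (auto simp: zero normal_mat_def)
next
  case (Suc m)
  let ?n = "Suc m"
  have A: "A \<in> carrier_mat ?n ?n"
    using Suc.prems(3) by (simp add: normal_mat_def)
  have cp: "char_poly A = [:- ev 0, 1:] * (\<Prod>i<m. [:- ev (Suc i), 1:])"
    using Suc.prems(4) by (simp add: prod.lessThan_Suc_shift del: prod.lessThan_Suc)
  have "eigenvalue A (ev 0)"
    unfolding eigenvalue_root_char_poly[OF A] cp by simp
  then obtain v where v: "v \<in> carrier_vec ?n" "v \<noteq> 0\<^sub>v ?n" "A *\<^sub>v v = ev 0 \<cdot>\<^sub>v v"
    using A by (auto simp: eigenvalue_def eigenvector_def)
  obtain W c where W: "W \<in> carrier_mat ?n ?n"
    and unitary: "mat_adjoint W * W = 1\<^sub>m ?n" "W * mat_adjoint W = 1\<^sub>m ?n"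
    and colW: "col W 0 = c \<cdot>\<^sub>v v"
    using unitary_completion[OF v(1,2)] .
  note W' = mat_adjoint_carrier[OF W]
  \<comment> \<open>\<open>A\<close> in an orthonormal basis whose first vector is an eigenvector
    for \<open>ev 0\<close>. Its first column is therefore \<open>ev 0\<close> times the first unit
    vector, and normality splits it into blocks.\<close>
  define A' where "A' = mat_adjoint W * A * W"
  have A': "A' \<in> carrier_mat ?n ?n"
    using A W W' by (auto simp: A'_def)
  have "A *\<^sub>v col W 0 = ev 0 \<cdot>\<^sub>v col W 0"
    using A v by (simp add: colW mult_mat_vec[of _ ?n ?n] smult_smult_assoc mult.commute)
  moreover have "col A' 0 = mat_adjoint W *\<^sub>v (A *\<^sub>v col W 0)"
  proof -
    have "A' = mat_adjoint W * (A * W)"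
      unfolding A'_def by (rule assoc_mult_mat[OF W' A W])
    then have "col A' 0 = mat_adjoint W *\<^sub>v col (A * W) 0"
      using col_mult2[OF W' mult_carrier_mat[OF A W], of 0] by simp
    then show ?thesis
      using col_mult2[OF A W, of 0] by simp
  qed
  moreover have "mat_adjoint W *\<^sub>v (ev 0 \<cdot>\<^sub>v col W 0) = ev 0 \<cdot>\<^sub>v (mat_adjoint W *\<^sub>v col W 0)"
    by (rule mult_mat_vec[OF W' col_carrier_vec]) (use W in auto)
  ultimately have "col A' 0 = ev 0 \<cdot>\<^sub>v (mat_adjoint W *\<^sub>v col W 0)"
    by simp
  also have "mat_adjoint W *\<^sub>v col W 0 = unit_vec ?n 0"
    using W W' col_mult2[of "mat_adjoint W" ?n ?n W ?n 0] by (simp add: unitary)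
  finally obtain X where X: "X \<in> carrier_mat m m" "normal_mat m X"
    and AX: "A' = scalar_block m (ev 0) X"
    using normal_mat_split normal_mat_congruence[OF Suc.prems(3) W unitary(2)] by (metis A'_def)
  have decomp: "W * A' * mat_adjoint W = A"
  proof -
    have "W * A' * mat_adjoint W = (W * mat_adjoint W) * A * (W * mat_adjoint W)"
      using A W W' by (simp add: A'_def assoc_mult_mat[of _ ?n ?n _ ?n _ ?n] mult_carrier_mat[of _ ?n ?n _ ?n])
    then show ?thesis
      using A by (simp add: unitary)
  qed
  have "similar_mat_wit A A' W (mat_adjoint W)"
    using A A' W W' decomp unitary by (intro similar_mat_witI[of _ _ ?n]) auto
  then have "char_poly A' = char_poly A"
    using char_poly_similar similar_mat_def by metis
  \<comment> \<open>Both characteristic polynomials contain the factor \<open>[:- ev 0, 1:]\<close>.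
    It is kept unexpanded so that it cancels, leaving \<open>X\<close> exactly the remaining
    eigenvalues.\<close>
  then have cpX: "char_poly X = (\<Prod>i<m. [:- ev (Suc i), 1:])"
    unfolding AX char_poly_scalar_block[OF X(1)] cp by (simp del: mult_pCons_left)
  \<comment> \<open>\<open>\<phi>\<close> in the new basis: it takes at \<open>A'\<close> and at the
    identity the values of \<open>\<phi>\<close> at \<open>A\<close> and at the identity.\<close>
  define \<psi> where "\<psi> Y = \<phi> (W * Y * mat_adjoint W)" for Y
  have \<psi>: "linear_functional ?n \<psi>" "positive_functional ?n \<psi>"
    using linear_functional_congruence[OF Suc.prems(1) W]
      positive_functional_congruence[OF Suc.prems(2) W] by (simp_all add: \<psi>_def[abs_def])
  obtain w :: "nat \<Rightarrow> real" where w: "\<forall>i<m. (0::real) \<le> w i"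
    "\<psi> (scalar_block m 0 (1\<^sub>m m)) = (\<Sum>i<m. w i)"
    "\<psi> (scalar_block m 0 X) = (\<Sum>i<m. w i * ev (Suc i))"
    using Suc.IH[OF linear_functional_scalar_block[OF \<psi>(1)]
        positive_functional_scalar_block[OF \<psi>(2)] X(2) cpX] by blast
  \<comment> \<open>The weight of \<open>ev 0\<close>. It is real and nonnegative because it is the
    value of a positive functional at a positive semidefinite matrix.\<close>
  define p where "p = \<psi> (scalar_block m 1 (0\<^sub>m m m))"
  have "0\<^sub>m m m *\<^sub>v v = (0\<^sub>v m :: complex vec)" if "v \<in> carrier_vec m" for v
    using that by (intro eq_vecI) auto
  then have "pos_semidef m (0\<^sub>m m m)"
    by (simp add: pos_semidef_def)
  then have "pos_semidef ?n (scalar_block m 1 (0\<^sub>m m m))"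
    by (rule pos_semidef_scalar_block) (simp add: less_eq_complex_def)
  then have "0 \<le> p"
    using \<psi>(2) by (simp add: p_def positive_functional_def)
  then have p: "p = of_real (Re p)" "0 \<le> Re p"
    by (auto simp: less_eq_complex_def complex_eq_iff)
  define u where "u i = (case i of 0 \<Rightarrow> Re p | Suc j \<Rightarrow> w j)" for i
  have "\<phi> (1\<^sub>m ?n) = \<psi> (scalar_block m 1 (1\<^sub>m m))"
    using W unitary by (simp add: \<psi>_def scalar_block_one)
  also have "\<dots> = (\<Sum>i<?n. u i)"
    using linear_functional_decompose[OF \<psi>(1), of "1\<^sub>m m" 1] w(2) p(1)
    by (simp add: sum.lessThan_Suc_shift u_def flip: p_def del: sum.lessThan_Suc)
  finally have one: "\<phi> (1\<^sub>m ?n) = (\<Sum>i<?n. u i)" .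
  have "\<phi> A = \<psi> (scalar_block m (ev 0) X)"
    by (simp add: \<psi>_def decomp flip: AX)
  also have "\<dots> = (\<Sum>i<?n. u i * ev i)"
    using linear_functional_decompose[OF \<psi>(1) X(1), of "ev 0"] w(3) p(1)
    by (simp add: sum.lessThan_Suc_shift u_def mult.commute flip: p_def del: sum.lessThan_Suc)
  finally have "\<phi> A = (\<Sum>i<?n. u i * ev i)" .
  moreover have "\<forall>i<?n. 0 \<le> u i"
    using w(1) p(2) by (auto simp: u_def split: nat.split)
  ultimately show ?case
    using one by blast
qed

section \<open>Convex combinations of eigenvalues and their differences\<close>

corollary state_normal_convex_combination:
  fixes \<phi> :: "complex mat \<Rightarrow> complex" and ev :: "nat \<Rightarrow> complex"
  assumes "linear_functional n \<phi>" "positive_functional n \<phi>" "unital_functional n \<phi>"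
    and "normal_mat n A" "eigenvalue_enum n A ev"
  obtains w :: "nat \<Rightarrow> real" where "\<And>i. i \<in> {1..n} \<Longrightarrow> 0 \<le> w i" "(\<Sum>i=1..n. w i) = 1"
    "\<phi> A = (\<Sum>i=1..n. w i * ev i)"
proof -
  have "char_poly A = (\<Prod>i<n. [:- ev (Suc i), 1:])"
    using assms(5) by (simp add: eigenvalue_enum_def prod.atLeast1_atMost_eq)
  from positive_functional_normal[OF assms(1,2,4) this]
  obtain w :: "nat \<Rightarrow> real" where w: "\<forall>i<n. (0::real) \<le> w i" "\<phi> (1\<^sub>m n) = (\<Sum>i<n. w i)"
    "\<phi> A = (\<Sum>i<n. w i * ev (Suc i))"
    by blast
  have "(\<Sum>i<n. w i) = (1::real)"
    using w(2) assms(3) by (metis unital_functional_def of_real_eq_1_iff of_real_sum)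
  \<comment> \<open>The induction numbers the eigenvalues from 0, the enumeration from 1; the
    weights are shifted to match.\<close>
  then show thesis
    using w(1,3) by (intro that[of "\<lambda>i. w (i - 1)"]) (auto simp: sum.atLeast1_atMost_eq)
qed

text \<open>Multiplying each sum by the total weight 1 of the other writes both as double sums with
  the weights \<open>a i * b j\<close>. Their difference is then an average of the numbers
  \<open>x i - y j\<close>, each of modulus at most \<open>M\<close>.\<close>

lemma convex_combination_diff_bound:
  fixes a b :: "nat \<Rightarrow> real" and x y :: "nat \<Rightarrow> complex"
  assumes a: "\<And>i. i \<in> I \<Longrightarrow> 0 \<le> a i" "sum a I = 1"
    and b: "\<And>j. j \<in> J \<Longrightarrow> 0 \<le> b j" "sum b J = 1"
    and M: "\<And>i j. i \<in> I \<Longrightarrow> j \<in> J \<Longrightarrow> cmod (x i - y j) \<le> M"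
  shows "cmod ((\<Sum>i\<in>I. a i * x i) - (\<Sum>j\<in>J. b j * y j)) \<le> M"
proof -
  have "(\<Sum>i\<in>I. a i * x i) = (\<Sum>i\<in>I. a i * x i) * of_real (sum b J)"
    by (simp add: b)
  also have "\<dots> = (\<Sum>i\<in>I. \<Sum>j\<in>J. of_real (a i * b j) * x i)"
    unfolding of_real_sum sum_product by (simp add: mult_ac)
  finally have x: "(\<Sum>i\<in>I. a i * x i) = (\<Sum>i\<in>I. \<Sum>j\<in>J. of_real (a i * b j) * x i)" .
  have "(\<Sum>j\<in>J. b j * y j) = of_real (sum a I) * (\<Sum>j\<in>J. b j * y j)"
    by (simp add: a)
  also have "\<dots> = (\<Sum>i\<in>I. \<Sum>j\<in>J. of_real (a i * b j) * y j)"
    unfolding of_real_sum sum_product by (simp add: mult_ac)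
  finally have "(\<Sum>i\<in>I. a i * x i) - (\<Sum>j\<in>J. b j * y j)
      = (\<Sum>i\<in>I. \<Sum>j\<in>J. of_real (a i * b j) * (x i - y j))"
    unfolding x by (simp add: sum_subtractf right_diff_distrib)
  also have "cmod \<dots> \<le> (\<Sum>i\<in>I. \<Sum>j\<in>J. a i * b j * M)"
  proof (intro sum_norm_le)
    fix i j assume "i \<in> I" "j \<in> J"
    then show "cmod (of_real (a i * b j) * (x i - y j)) \<le> a i * b j * M"
      using a(1) b(1) M by (simp add: norm_mult mult_left_mono)
  qed
  also have "\<dots> = sum a I * sum b J * M"
    by (simp only: sum_product flip: sum_distrib_right)
  finally show ?thesis
    by (simp add: a b)
qed

theorem corollary2p1:
  fixes n :: nat
    and \<phi>\<^sub>1 \<phi>\<^sub>2 :: "complex mat \<Rightarrow> complex"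
    and A B :: "complex mat"
    and \<alpha> \<beta> :: "nat \<Rightarrow> complex"
  assumes "linear_functional n \<phi>\<^sub>1" "positive_functional n \<phi>\<^sub>1" "unital_functional n \<phi>\<^sub>1"
    and "linear_functional n \<phi>\<^sub>2" "positive_functional n \<phi>\<^sub>2" "unital_functional n \<phi>\<^sub>2"
    and "normal_mat n A" "normal_mat n B"
    and "eigenvalue_enum n A \<alpha>" "eigenvalue_enum n B \<beta>"
  shows "cmod (\<phi>\<^sub>1 A - \<phi>\<^sub>2 B)
           \<le> Max ((\<lambda>(i, j). cmod (\<alpha> i - \<beta> j)) ` ({1..n} \<times> {1..n}))"
proof -
  obtain a :: "nat \<Rightarrow> real" where a: "\<And>i. i \<in> {1..n} \<Longrightarrow> 0 \<le> a i" "(\<Sum>i=1..n. a i) = 1"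
    "\<phi>\<^sub>1 A = (\<Sum>i=1..n. a i * \<alpha> i)"
    using state_normal_convex_combination[OF assms(1-3,7,9)] by blast
  obtain b :: "nat \<Rightarrow> real" where b: "\<And>i. i \<in> {1..n} \<Longrightarrow> 0 \<le> b i" "(\<Sum>i=1..n. b i) = 1"
    "\<phi>\<^sub>2 B = (\<Sum>i=1..n. b i * \<beta> i)"
    using state_normal_convex_combination[OF assms(4-6,8,10)] by blast
  \<comment> \<open>The case \<open>n = 0\<close>, where the maximum ranges over the empty set,
    needs no separate treatment: empty sums of weights cannot equal 1, so the assumptions already
    contradict each other.\<close>
  show ?thesis
    unfolding a(3) b(3)
  proof (rule convex_combination_diff_bound[OF a(1,2) b(1,2)])
    fix i j assume "i \<in> {1..n}" "j \<in> {1..n}"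
    then show "cmod (\<alpha> i - \<beta> j) \<le> Max ((\<lambda>(i, j). cmod (\<alpha> i - \<beta> j)) ` ({1..n} \<times> {1..n}))"
      by (intro Max_ge) auto
  qed
qed

end
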